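(* For every $n$, let $T$ be a random tournament on alternatives $x_1,\dots,x_n$ generated according to the generalized random model with probabilities $p_{i,j}$ satisfying $p_{i,j} \in \left[50 (\log\log n)/n,\ 1 - 50 (\log\log n)/n\right]$ for all $i\neq j$. Then with high probability (i.e., with probability tending to $1$ as $n\to\infty$), every alternative in $T$ is a $5$-king.
   Context: A tournament on a finite set $V$ of alternatives is a complete orientation: for every two distinct $x,y\in V$ exactly one of $x\succ y$ ("$x$ dominates $y$") or $y\succ x$ holds. For an integer $k\ge 2$, an alternative $x$ is a $k$-king if for every other alternative $y$ there is a directed path from $x$ to $y$ of length (number of edges) at most $k$. Generalized random model: for each ordered pair $i\neq j$ there is a number $p_{i,j}\in[0,1]$ with $p_{i,j}+p_{j,i}=1$; independently for each unordered pair $\{i,j\}$, $x_i\succ x_j$ with probability $p_{i,j}$ and otherwise $x_j\succ x_i$. $\log$ is the natural logarithm. *)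

theory Defs
  imports "HOL-Probability.Probability" "Graph_Theory.Pair_Digraph"
begin

definition tournament :: "'a pair_pre_digraph \<Rightarrow> bool" where
  "tournament T \<longleftrightarrow> pair_digraph T \<and>
     (\<forall>x\<in>pverts T. \<forall>y\<in>pverts T. x \<noteq> y \<longrightarrow> ((x, y) \<in> parcs T \<longleftrightarrow> (y, x) \<notin> parcs T))"

(* The library's apath is a walk without repeated vertices, given by its list of arcs. *)
definition king :: "nat \<Rightarrow> 'a pair_pre_digraph \<Rightarrow> 'a \<Rightarrow> bool" where
  "king k T x \<longleftrightarrow> x \<in> pverts T \<and>
     (\<forall>y\<in>pverts T. y \<noteq> x \<longrightarrow>
        (\<exists>es. pre_digraph.apath (with_proj T) x es y \<and> length es \<le> k))"

definition valid_probs :: "nat \<Rightarrow> (nat \<Rightarrow> nat \<Rightarrow> real) \<Rightarrow> bool" where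
  "valid_probs n p \<longleftrightarrow>
     (\<forall>i\<in>{1..n}. \<forall>j\<in>{1..n}. i \<noteq> j \<longrightarrow> p i j \<in> {0..1} \<and> p i j + p j i = 1)"

(* An unordered pair is represented by (i, j) with i < j; the coin c (i, j) is True
   if i dominates j and False if j dominates i. *)
definition unordered_pairs :: "nat \<Rightarrow> (nat \<times> nat) set" where
  "unordered_pairs n = {(i, j). 1 \<le> i \<and> i < j \<and> j \<le> n}"

definition tournament_of :: "nat \<Rightarrow> (nat \<times> nat \<Rightarrow> bool) \<Rightarrow> nat pair_pre_digraph" where
  "tournament_of n c =
     \<lparr> pverts = {1..n},
       parcs = {(i, j). (i, j) \<in> unordered_pairs n \<and> c (i, j) \<or>
                        (j, i) \<in> unordered_pairs n \<and> \<not> c (j, i)} \<rparr>"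

definition random_tournament ::
    "nat \<Rightarrow> (nat \<Rightarrow> nat \<Rightarrow> real) \<Rightarrow> nat pair_pre_digraph pmf" where
  "random_tournament n p =
     map_pmf (tournament_of n)
       (Pi_pmf (unordered_pairs n) False (\<lambda>(i, j). bernoulli_pmf (p i j)))"

lemma finite_unordered_pairs: "finite (unordered_pairs n)"
  by (rule finite_subset[of _ "{1..n} \<times> {1..n}"]) (auto simp: unordered_pairs_def)

lemma tournament_tournament_of: "tournament (tournament_of n c)"
proof -
  have fin: "finite (parcs (tournament_of n c))"
    by (rule finite_subset[of _ "{1..n} \<times> {1..n}"])
      (auto simp: tournament_of_def unordered_pairs_def)
  have "pair_digraph (tournament_of n c)"
    using fin by unfold_locales (auto simp: tournament_of_def unordered_pairs_def)
  then show ?thesis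
    unfolding tournament_def by (auto simp: tournament_of_def unordered_pairs_def)
qed

lemma tournament_random_tournament:
  "T \<in> set_pmf (random_tournament n p) \<Longrightarrow> tournament T"
  by (auto simp: random_tournament_def tournament_tournament_of)

lemma prob_dominates:
  assumes "valid_probs n p" "i \<in> {1..n}" "j \<in> {1..n}" "i \<noteq> j"
  shows "measure_pmf.prob (random_tournament n p) {T. (i, j) \<in> parcs T} = p i j"
proof -
  let ?P = "Pi_pmf (unordered_pairs n) False (\<lambda>(i, j). bernoulli_pmf (p i j))"
  have coin: "measure_pmf.prob ?P {c. c (a, b) = v} = pmf (bernoulli_pmf (p a b)) v"
    if "(a, b) \<in> unordered_pairs n" for a b v
  proof -
    have "map_pmf (\<lambda>c. c (a, b)) ?P = bernoulli_pmf (p a b)"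
      using that by (simp add: Pi_pmf_component finite_unordered_pairs)
    then have "measure_pmf.prob (map_pmf (\<lambda>c. c (a, b)) ?P) {v} = pmf (bernoulli_pmf (p a b)) v"
      by (simp add: measure_pmf_single)
    then show ?thesis
      by (simp add: measure_map_pmf vimage_def)
  qed
  have val: "p i j \<in> {0..1}" "p j i \<in> {0..1}" "p i j + p j i = 1"
    using assms by (auto simp: valid_probs_def)
  show ?thesis
  proof (cases "i < j")
    case True
    then have "(i, j) \<in> unordered_pairs n" "(j, i) \<notin> unordered_pairs n"
      using assms by (auto simp: unordered_pairs_def)
    then show ?thesis
      using coin[of i j True] val
      by (simp add: random_tournament_def measure_map_pmf vimage_def tournament_of_def)
  next
    case False
    then have "(j, i) \<in> unordered_pairs n" "(i, j) \<notin> unordered_pairs n"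
      using assms by (auto simp: unordered_pairs_def)
    then show ?thesis
      using coin[of j i False] val
      by (simp add: random_tournament_def measure_map_pmf vimage_def tournament_of_def)
  qed
qed

end

theory Submission
  imports Defs "HOL-Real_Asymp.Real_Asymp"
begin

text \<open>
  Put \<open>\<delta> = 50 log log n / n\<close>, so that every arc has probability at least \<open>\<delta>\<close>. Since a set \<open>S\<close> of
  vertices carries \<open>|S| (|S| - 1) / 2\<close> arcs, only \<open>O(d)\<close> vertices have expected out-degree below \<open>d\<close>.
  In particular more than half of the vertices are \<^emph>\<open>big\<close>, with expected (and hence, with high
  probability, actual) out-degree linear in \<open>n\<close>, and only \<open>O(log n)\<close> vertices are \<^emph>\<open>low\<close>, with expected
  out-degree below \<open>8 log n\<close>.

  A low vertex fails to dominate a big one with probability at most a large negative power of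
  \<open>log n\<close>, which survives the union bound over the few low vertices. A vertex that is not low
  reaches a big one in at most two steps, with failure probability at most \<open>n\<^sup>-\<^sup>4\<close>: each of its logarithmically
  many out-neighbours misses all big vertices with probability only \<open>exp (- \<Omega>(\<delta> n))\<close>. The same estimate
  in the reversed tournament, applied to the linearly large out-neighbourhood of a big vertex \<open>w\<close>,
  shows that \<open>w\<close> reaches in at most three steps every \<open>y\<close> of expected in-degree at least \<open>8 log n\<close>.
  These paths and their reversals combine to paths of length at most \<open>5\<close>.
\<close>

section \<open>Independence of functions of disjoint sets of coins\<close>

text \<open>Dependence on the coins in \<open>I\<close> alone, stated for functions rather than
  sigma-algebras; over finite products this is enough to factor expectations.\<close>

definition determined_by :: "'e set \<Rightarrow> (('e \<Rightarrow> 'b) \<Rightarrow> 'c) \<Rightarrow> bool" where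
  "determined_by I f \<longleftrightarrow> (\<forall>c c'. (\<forall>e\<in>I. c e = c' e) \<longrightarrow> f c = f c')"

lemma determined_byI:
  assumes "\<And>c c'. (\<And>e. e \<in> I \<Longrightarrow> c e = c' e) \<Longrightarrow> f c = f c'"
  shows "determined_by I f"
  unfolding determined_by_def using assms by blast

lemma determined_byD:
  assumes "determined_by I f" "\<And>e. e \<in> I \<Longrightarrow> c e = c' e"
  shows "f c = f c'"
  using assms unfolding determined_by_def by blast

lemma determined_by_comp: "determined_by I f \<Longrightarrow> determined_by I (\<lambda>c. h (f c))"
  unfolding determined_by_def by metis

lemma expectation_pair_pmf_mult:
  fixes f :: "'a \<Rightarrow> real" and g :: "'b \<Rightarrow> real"
  assumes "finite (set_pmf A)" "finite (set_pmf B)"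
  shows "measure_pmf.expectation (pair_pmf A B) (\<lambda>(a, b). f a * g b) =
         measure_pmf.expectation A f * measure_pmf.expectation B g"
proof -
  have "measure_pmf.expectation (pair_pmf A B) (\<lambda>(a, b). f a * g b) =
        (\<Sum>(a, b)\<in>set_pmf A \<times> set_pmf B. (f a * pmf A a) * (g b * pmf B b))"
    using assms
    by (subst integral_measure_pmf_real[of "set_pmf A \<times> set_pmf B"])
       (auto simp: pmf_pair intro!: sum.cong)
  also have "\<dots> = (\<Sum>a\<in>set_pmf A. f a * pmf A a) * (\<Sum>b\<in>set_pmf B. g b * pmf B b)"
    by (simp add: sum_product sum.cartesian_product)
  finally show ?thesis
    using assms by (simp add: integral_measure_pmf_real[of "set_pmf A"]
                              integral_measure_pmf_real[of "set_pmf B"])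
qed

lemma finite_set_Pi_pmf:
  fixes B :: "'e \<Rightarrow> ('b::finite) pmf"
  assumes "finite U"
  shows "finite (set_pmf (Pi_pmf U dflt B))"
  using assms by (simp add: set_Pi_pmf finite_PiE_dflt)

lemma integrable_Pi_pmf:
  fixes B :: "'e \<Rightarrow> ('b::finite) pmf" and f :: "('e \<Rightarrow> 'b) \<Rightarrow> real"
  assumes "finite U"
  shows "integrable (measure_pmf (Pi_pmf U dflt B)) f"
  using assms by (intro integrable_measure_pmf_finite finite_set_Pi_pmf)

text \<open>Splitting the coins into those in \<open>I\<close> and the remaining ones turns the
  product pmf into a pair; disjointness lets \<open>g\<close> ignore the first component.\<close>

lemma expectation_Pi_pmf_mult:
  fixes f g :: "('e \<Rightarrow> 'b::finite) \<Rightarrow> real"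
  assumes U: "finite U" and I: "I \<subseteq> U" and f: "determined_by I f" and g: "determined_by J g"
    and disj: "I \<inter> J = {}"
  shows "measure_pmf.expectation (Pi_pmf U dflt B) (\<lambda>c. f c * g c) =
         measure_pmf.expectation (Pi_pmf U dflt B) f * measure_pmf.expectation (Pi_pmf U dflt B) g"
proof -
  let ?P = "Pi_pmf I dflt B" and ?Q = "Pi_pmf (U - I) dflt B"
  have fin: "finite I" "finite (U - I)"
    using U I finite_subset by auto
  \<comment> \<open>Stated for arbitrary \<open>f'\<close> and \<open>g'\<close> so that the
    constant 1 on one side identifies the marginal expectations.\<close>
  have split: "measure_pmf.expectation (Pi_pmf U dflt B) (\<lambda>c. f' c * g' c) =
         measure_pmf.expectation ?P f' * measure_pmf.expectation ?Q g'"
    if f': "determined_by I f'" and g': "determined_by J g'"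
    for f' g' :: "('e \<Rightarrow> 'b) \<Rightarrow> real"
  proof -
    have "Pi_pmf U dflt B = Pi_pmf (I \<union> (U - I)) dflt B"
      using I by (simp add: Un_absorb1)
    also have "\<dots> = map_pmf (\<lambda>(a, b) e. if e \<in> I then a e else b e) (pair_pmf ?P ?Q)"
      by (rule Pi_pmf_union) (use fin in auto)
    finally have eq: "Pi_pmf U dflt B = \<dots>" .
    have "f' (\<lambda>e. if e \<in> I then a e else b e) = f' a" for a b
      by (rule determined_byD[OF f']) auto
    moreover have "g' (\<lambda>e. if e \<in> I then a e else b e) = g' b" for a b
      by (rule determined_byD[OF g']) (use disj in auto)
    ultimately have "measure_pmf.expectation (Pi_pmf U dflt B) (\<lambda>c. f' c * g' c) =
        measure_pmf.expectation (pair_pmf ?P ?Q) (\<lambda>(a, b). f' a * g' b)"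
      unfolding eq by (simp add: case_prod_unfold)
    then show ?thesis
      by (simp add: expectation_pair_pmf_mult finite_set_Pi_pmf fin)
  qed
  have const: "determined_by K (\<lambda>c. 1 :: real)" for K :: "'e set"
    by (simp add: determined_by_def)
  have "measure_pmf.expectation (Pi_pmf U dflt B) f = measure_pmf.expectation ?P f"
    using split[OF f const] by simp
  moreover have "measure_pmf.expectation (Pi_pmf U dflt B) g = measure_pmf.expectation ?Q g"
    using split[OF const g] by simp
  ultimately show ?thesis
    using split[OF f g] by simp
qed

lemma expectation_Pi_pmf_prod:
  fixes f :: "'k \<Rightarrow> ('e \<Rightarrow> 'b::finite) \<Rightarrow> real"
  assumes U: "finite U" and K: "finite K"
    and "\<And>k. k \<in> K \<Longrightarrow> I k \<subseteq> U" "\<And>k. k \<in> K \<Longrightarrow> determined_by (I k) (f k)"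
    and "disjoint_family_on I K"
  shows "measure_pmf.expectation (Pi_pmf U dflt B) (\<lambda>c. \<Prod>k\<in>K. f k c) =
         (\<Prod>k\<in>K. measure_pmf.expectation (Pi_pmf U dflt B) (f k))"
  using K assms(3-)
proof (induction K rule: finite_induct)
  case (insert k K)
  have "determined_by (\<Union>i\<in>K. I i) (\<lambda>c. \<Prod>i\<in>K. f i c)"
  proof (rule determined_byI)
    fix c c' :: "'e \<Rightarrow> 'b"
    assume "\<And>e. e \<in> (\<Union>i\<in>K. I i) \<Longrightarrow> c e = c' e"
    then have "f i c = f i c'" if "i \<in> K" for i
      using that insert.prems(2)[of i] by (intro determined_byD[of "I i" "f i"]) auto
    then show "(\<Prod>i\<in>K. f i c) = (\<Prod>i\<in>K. f i c')"
      by (intro prod.cong) auto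
  qed
  moreover have "I k \<inter> (\<Union>i\<in>K. I i) = {}"
    using insert.hyps insert.prems(3) by (auto simp: disjoint_family_on_def)
  moreover have "disjoint_family_on I K"
    using insert.prems(3) by (auto simp: disjoint_family_on_def)
  ultimately show ?case
    using insert.hyps insert.prems insert.IH
      expectation_Pi_pmf_mult[OF U, of "I k" "f k" "\<Union>i\<in>K. I i" "\<lambda>c. \<Prod>i\<in>K. f i c"]
    by simp
qed simp

section \<open>Indicators and union bounds\<close>

lemma prob_eq_expectation:
  "measure_pmf.prob P {c. Q c} = measure_pmf.expectation P (\<lambda>c. of_bool (Q c))"
proof -
  have "(\<lambda>c. of_bool (Q c) :: real) = indicator {c. Q c}"
    by (auto simp: indicator_def)
  then show ?thesis by simp
qed

lemma prod_of_bool: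
  "finite W \<Longrightarrow> (\<Prod>u\<in>W. of_bool (Q u) :: real) = of_bool (\<forall>u\<in>W. Q u)"
  by (induction W rule: finite_induct) auto

lemma prob_Ex_le:
  fixes b :: real
  assumes "finite X" "\<And>x. x \<in> X \<Longrightarrow> measure_pmf.prob P {c. Q x c} \<le> b"
  shows "measure_pmf.prob P {c. \<exists>x\<in>X. Q x c} \<le> card X * b"
proof -
  have "measure_pmf.prob P {c. \<exists>x\<in>X. Q x c} = measure_pmf.prob P (\<Union>x\<in>X. {c. Q x c})"
    by (rule arg_cong[where f = "measure_pmf.prob P"]) auto
  also have "\<dots> \<le> (\<Sum>x\<in>X. measure_pmf.prob P {c. Q x c})"
    using assms(1) by (intro measure_pmf.finite_measure_subadditive_finite) auto
  also have "\<dots> \<le> card X * b"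
    using assms(2) by (intro sum_bounded_above)
  finally show ?thesis .
qed

lemma prob_mono:
  assumes "\<And>c. Q c \<Longrightarrow> R c"
  shows "measure_pmf.prob P {c. Q c} \<le> measure_pmf.prob P {c. R c}"
  using assms by (intro measure_pmf.finite_measure_mono Collect_mono) simp_all

lemma prob_not: "measure_pmf.prob P {c. \<not> Q c} = 1 - measure_pmf.prob P {c. Q c}"
  using measure_pmf.prob_compl[of "{c. Q c}" P]
  by (simp add: Compl_eq_Diff_UNIV[symmetric] Collect_neg_eq)

lemma prob_disj_le:
  "measure_pmf.prob P {c. Q c \<or> R c} \<le> measure_pmf.prob P {c. Q c} + measure_pmf.prob P {c. R c}"
  unfolding Collect_disj_eq by (rule measure_Un_le) auto

lemma half_le_one_minus_exp:
  assumes "1 \<le> (t::real)"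
  shows "1 / 2 \<le> 1 - exp (- t)"
proof -
  have "2 \<le> exp t" using exp_ge_add_one_self[of t] assms by linarith
  then show ?thesis by (simp add: exp_minus field_simps)
qed

section \<open>Reflexive powers of a relation\<close>

text \<open>Reflexive steps act as pauses, so \<open>R\<^sup>= ^^ k\<close> describes reachability
  in at most \<open>k\<close> steps.\<close>

lemma relpow_reflcl_mono:
  assumes "(x, y) \<in> R\<^sup>= ^^ j" "j \<le> k"
  shows "(x, y) \<in> R\<^sup>= ^^ k"
proof -
  have "R\<^sup>= ^^ j \<subseteq> R\<^sup>= ^^ (j + m)" for m
    by (induction m) auto
  from this[of "k - j"] show ?thesis using assms by auto
qed

lemma relpow_reflcl_add:
  assumes "(x, y) \<in> R\<^sup>= ^^ j" "(y, z) \<in> R\<^sup>= ^^ k" "j + k \<le> l"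
  shows "(x, z) \<in> R\<^sup>= ^^ l"
proof -
  have "(x, z) \<in> R\<^sup>= ^^ (j + k)"
    using assms by (auto simp: relpow_add)
  then show ?thesis using assms(3) by (rule relpow_reflcl_mono)
qed

lemma relpow_mono:
  fixes R S :: "'a rel"
  assumes "R \<subseteq> S"
  shows "R ^^ k \<subseteq> S ^^ k"
  using assms by (induction k) auto

lemma relpow_converse:
  fixes R :: "'a rel"
  shows "R\<inverse> ^^ k = (R ^^ k)\<inverse>"
proof (induction k)
  case (Suc k)
  then show ?case
    using relpow_commute[of "R\<inverse>" k] by (simp add: converse_relcomp)
qed auto

section \<open>Short paths in random orientations\<close>

text \<open>The domination predicate \<open>D\<close> is a parameter so that the reversed tournament, over the same
  coins, is another instance of the locale.\<close>

locale random_orientation =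
  fixes V :: "'a set" and U :: "'e set" and dflt :: "'b::finite" and B :: "'e \<Rightarrow> 'b pmf"
    and edge :: "'a \<Rightarrow> 'a \<Rightarrow> 'e" and D :: "'a \<Rightarrow> 'a \<Rightarrow> ('e \<Rightarrow> 'b) \<Rightarrow> bool" and \<delta> :: real
  assumes finite_V: "finite V" and finite_U: "finite U"
    and edge_in: "\<lbrakk>i \<in> V; j \<in> V; i \<noteq> j\<rbrakk> \<Longrightarrow> edge i j \<in> U"
    and edge_commute: "edge i j = edge j i"
    and edge_eq: "\<lbrakk>i \<in> V; j \<in> V; i \<noteq> j; k \<in> V; l \<in> V; k \<noteq> l; edge i j = edge k l\<rbrakk> \<Longrightarrow> {i, j} = {k, l}"
    and determined_D: "\<lbrakk>i \<in> V; j \<in> V; i \<noteq> j\<rbrakk> \<Longrightarrow> determined_by {edge i j} (D i j)"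
    and D_antisym: "\<lbrakk>i \<in> V; j \<in> V; i \<noteq> j\<rbrakk> \<Longrightarrow> D i j c \<longleftrightarrow> \<not> D j i c"
    and delta_nonneg: "0 \<le> \<delta>"
    and delta_le: "\<lbrakk>i \<in> V; j \<in> V; i \<noteq> j\<rbrakk> \<Longrightarrow>
           \<delta> \<le> measure_pmf.prob (Pi_pmf U dflt B) {c. D i j c}"
begin

section \<open>Arc probabilities and expected degrees\<close>

definition P :: "('e \<Rightarrow> 'b) pmf" where "P = Pi_pmf U dflt B"

definition q :: "'a \<Rightarrow> 'a \<Rightarrow> real" where "q i j = measure_pmf.prob P {c. D i j c}"

abbreviation E :: "(('e \<Rightarrow> 'b) \<Rightarrow> real) \<Rightarrow> real" where "E \<equiv> measure_pmf.expectation P"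

lemma integrable_P [simp]: "integrable (measure_pmf P) (f :: _ \<Rightarrow> real)"
  unfolding P_def by (rule integrable_Pi_pmf) (rule finite_U)

lemma reverse: "random_orientation V U dflt B edge (\<lambda>i j. D j i) \<delta>"
proof (unfold_locales, goal_cases)
  case (6 i j)
  then show ?case
    using determined_D[of j i] edge_commute[of i j] by simp
next
  case (7 i j c)
  then show ?case
    using D_antisym[of i j c] by simp
qed (fact finite_V finite_U edge_in edge_commute edge_eq delta_nonneg | simp add: delta_le)+

lemma q_bounds: "0 \<le> q i j" "q i j \<le> 1"
  unfolding q_def by auto

lemma q_ge: "\<lbrakk>i \<in> V; j \<in> V; i \<noteq> j\<rbrakk> \<Longrightarrow> \<delta> \<le> q i j"
  unfolding q_def P_def by (rule delta_le)

lemma prob_not_D: "measure_pmf.prob P {c. \<not> D i j c} = 1 - q i j"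
  unfolding q_def by (rule prob_not)

lemma q_reverse: "\<lbrakk>i \<in> V; j \<in> V; i \<noteq> j\<rbrakk> \<Longrightarrow> q i j + q j i = 1"
  using prob_not_D[of i j] D_antisym[of j i] by (simp add: q_def)

lemma expectation_D: "E (\<lambda>c. of_bool (D i j c)) = q i j"
  unfolding q_def by (rule prob_eq_expectation[symmetric])

lemma expectation_not_D: "E (\<lambda>c. of_bool (\<not> D i j c)) = 1 - q i j"
  unfolding prob_not_D[symmetric] by (rule prob_eq_expectation[symmetric])

lemma determined_byD_D:
  assumes "\<And>e. e \<in> I \<Longrightarrow> c e = c' e" "edge i j \<in> I" "i \<in> V" "j \<in> V" "i \<noteq> j"
  shows "D i j c = D i j c'"
  using assms by (intro determined_byD[OF determined_D]) auto

lemma expectation_mult: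
  assumes "I \<subseteq> U" "determined_by I f" "determined_by J g" "I \<inter> J = {}"
  shows "E (\<lambda>c. f c * g c) = E f * E g"
  unfolding P_def using finite_U assms by (intro expectation_Pi_pmf_mult) auto

lemma expectation_prod:
  assumes "finite K" "\<And>k. k \<in> K \<Longrightarrow> I k \<subseteq> U" "\<And>k. k \<in> K \<Longrightarrow> determined_by (I k) (f k)"
    "disjoint_family_on I K"
  shows "E (\<lambda>c. \<Prod>k\<in>K. f k c) = (\<Prod>k\<in>K. E (f k))"
  unfolding P_def using finite_U assms by (intro expectation_Pi_pmf_prod) auto

definition out_mean :: "'a \<Rightarrow> real" where "out_mean x = (\<Sum>u\<in>V - {x}. q x u)"

definition in_mean :: "'a \<Rightarrow> real" where "in_mean y = (\<Sum>u\<in>V - {y}. q u y)"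

definition out_nbrs :: "'a \<Rightarrow> ('e \<Rightarrow> 'b) \<Rightarrow> 'a set" where
  "out_nbrs x c = {u \<in> V - {x}. D x u c}"

section \<open>Two-step paths into a fixed set\<close>

lemma edge_star_disjoint:
  assumes "u \<in> V" "S \<subseteq> V - {u}"
  shows "disjoint_family_on (\<lambda>s. {edge u s}) S"
  unfolding disjoint_family_on_def
proof (intro ballI impI)
  fix m n assume *: "m \<in> S" "n \<in> S" "m \<noteq> n"
  then have "{u, m} \<noteq> {u, n}" "m \<in> V" "n \<in> V" "u \<noteq> m" "u \<noteq> n"
    using assms by (auto simp: doubleton_eq_iff)
  then show "{edge u m} \<inter> {edge u n} = {}"
    using edge_eq[of u m u n] assms(1) by blast
qed

text \<open>The edges at \<open>u\<close> are independent, and each factor \<open>1 - q u s\<close>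
  is at most \<open>1 - \<delta> \<le> exp (- \<delta>)\<close>. The product form is the one that
  occurs in the two-step estimate.\<close>

lemma expectation_no_out_nbr:
  assumes "u \<in> V" "S \<subseteq> V - {u}"
  shows "E (\<lambda>c. \<Prod>s\<in>S. of_bool (\<not> D u s c)) \<le> exp (- (\<delta> * card S))"
proof -
  have fin: "finite S" using assms finite_V finite_subset by blast
  have "E (\<lambda>c. \<Prod>s\<in>S. of_bool (\<not> D u s c)) = (\<Prod>s\<in>S. E (\<lambda>c. of_bool (\<not> D u s c)))"
  proof (rule expectation_prod[OF fin, where I = "\<lambda>s. {edge u s}"])
    fix s assume "s \<in> S"
    then have s: "u \<in> V" "s \<in> V" "u \<noteq> s" using assms by auto
    show "{edge u s} \<subseteq> U" using edge_in s by simp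
    show "determined_by {edge u s} (\<lambda>c. of_bool (\<not> D u s c))"
      by (rule determined_by_comp) (rule determined_D[OF s])
  qed (rule edge_star_disjoint[OF assms])
  also have "\<dots> \<le> (\<Prod>s\<in>S. exp (- \<delta>))"
  proof (rule prod_mono)
    fix s assume "s \<in> S"
    then have "\<delta> \<le> q u s" using assms by (intro q_ge) auto
    then show "0 \<le> E (\<lambda>c. of_bool (\<not> D u s c)) \<and> E (\<lambda>c. of_bool (\<not> D u s c)) \<le> exp (- \<delta>)"
      using q_bounds[of u s] exp_ge_add_one_self[of "- \<delta>"] unfolding expectation_not_D by linarith
  qed
  also have "\<dots> = exp (- (\<delta> * card S))"
    by (simp add: exp_of_nat_mult[symmetric] mult.commute)
  finally show ?thesis .
qed

text \<open>Each \<open>u \<in> W\<close> imposes one condition. Whether or not \<open>u\<close> lies in \<open>S\<close>, the edges it reads are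
  disjoint from those read by any other \<open>u\<close>, because for \<open>u \<in> S\<close> only the edge from \<open>x\<close> matters.
  So the probability is a product and nothing has to be conditioned on.\<close>

lemma prob_no_two_step:
  assumes x: "x \<in> V" and S: "S \<subseteq> V - {x}" and W: "W \<subseteq> V - {x}"
  shows "measure_pmf.prob P {c. \<forall>u\<in>W. D x u c \<longrightarrow> u \<notin> S \<and> (\<forall>s\<in>S. \<not> D u s c)}
          \<le> exp (- ((1 - exp (- (\<delta> * card S))) * (\<Sum>u\<in>W. q x u)))"
proof -
  define r where "r = exp (- (\<delta> * card S))"
  have r: "0 \<le> r" "r \<le> 1" using delta_nonneg by (auto simp: r_def)
  have finW: "finite W" and finS: "finite S" using assms finite_V finite_subset by blast+
  let ?Q = "\<lambda>u c. D x u c \<longrightarrow> u \<notin> S \<and> (\<forall>s\<in>S. \<not> D u s c)"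
  define I where "I u = (if u \<in> S then {edge x u} else insert (edge x u) (edge u ` S))" for u
  have "measure_pmf.prob P {c. \<forall>u\<in>W. ?Q u c} = E (\<lambda>c. \<Prod>u\<in>W. of_bool (?Q u c))"
    unfolding prob_eq_expectation using finW by (simp add: prod_of_bool)
  also have "\<dots> = (\<Prod>u\<in>W. E (\<lambda>c. of_bool (?Q u c)))"
  proof (rule expectation_prod[OF finW, where I = I])
    fix u assume u: "u \<in> W"
    then have *: "x \<in> V" "u \<in> V" "x \<noteq> u" using x W by auto
    show "I u \<subseteq> U" using * S by (auto simp: I_def intro!: edge_in)
    show "determined_by (I u) (\<lambda>c. of_bool (?Q u c))"
    proof (rule determined_byI)
      fix c c' :: "'e \<Rightarrow> 'b" assume c: "\<And>e. e \<in> I u \<Longrightarrow> c e = c' e"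
      have "D x u c = D x u c'"
        by (rule determined_byD_D[OF c]) (use * in \<open>auto simp: I_def\<close>)
      moreover have "D u s c = D u s c'" if "u \<notin> S" "s \<in> S" for s
        by (rule determined_byD_D[OF c]) (use * that S in \<open>auto simp: I_def\<close>)
      ultimately show "of_bool (?Q u c) = of_bool (?Q u c')"
        by auto
    qed
  next
    show "disjoint_family_on I W"
      unfolding disjoint_family_on_def
    proof (intro ballI impI)
      fix u v assume uv: "u \<in> W" "v \<in> W" "u \<noteq> v"
      have "edge x u \<noteq> edge x v" 
        using edge_eq[of x u x v] uv x W by (auto simp: doubleton_eq_iff)
      \<comment> \<open>\<open>x\<close> lies neither in \<open>W\<close> nor in \<open>S\<close>,
        so no edge between these sets touches \<open>x\<close>.\<close>
      moreover have "edge x a \<noteq> edge b s" if "a \<in> W" "b \<in> W" "s \<in> S" "b \<notin> S" for a b s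
        using edge_eq[of x a b s] that x W S by (auto simp: doubleton_eq_iff)
      \<comment> \<open>Equality would force \<open>u = t\<close> and \<open>s = v\<close>, against
        \<open>u \<notin> S\<close>: each such edge is read only from its end outside
        \<open>S\<close>.\<close>
      moreover have "edge u s \<noteq> edge v t" if "u \<notin> S" "v \<notin> S" "s \<in> S" "t \<in> S" for s t
        using edge_eq[of u s v t] that uv W S by (auto simp: doubleton_eq_iff)
      ultimately show "I u \<inter> I v = {}"
        using uv unfolding I_def by (auto split: if_splits)
    qed
  qed
  also have "\<dots> \<le> (\<Prod>u\<in>W. exp (- ((1 - r) * q x u)))"
  proof (rule prod_mono)
    fix u assume u: "u \<in> W"
    then have *: "x \<in> V" "u \<in> V" "x \<noteq> u" using x W by auto
    \<comment> \<open>The right-hand side is \<open>(1 - q x u) + q x u * r\<close>: either the arc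
      from \<open>x\<close> to \<open>u\<close> is absent, or it is present and \<open>u\<close>
      misses all of \<open>S\<close>.\<close>
    have "E (\<lambda>c. of_bool (?Q u c)) \<le> 1 - (1 - r) * q x u"
    proof (cases "u \<in> S")
      case True
      then have "E (\<lambda>c. of_bool (?Q u c)) = 1 - q x u"
        using expectation_not_D[of x u] by simp
      then show ?thesis
        using r q_bounds[of x u] mult_right_mono[of "1 - r" 1 "q x u"] by simp
    next
      case False
      let ?N = "\<lambda>c. \<Prod>s\<in>S. of_bool (\<not> D u s c) :: real"
      have SU: "S \<subseteq> V - {u}" using False S by auto
      have "of_bool (?Q u c) = of_bool (\<not> D x u c) + of_bool (D x u c) * ?N c" for c
        using False finS by (simp add: prod_of_bool)
      then have "E (\<lambda>c. of_bool (?Q u c)) = (1 - q x u) + E (\<lambda>c. of_bool (D x u c) * ?N c)"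
        by (simp add: expectation_not_D del: of_bool_not_iff)
      also have "E (\<lambda>c. of_bool (D x u c) * ?N c) = q x u * E ?N"
      proof (subst expectation_mult[where I = "{edge x u}" and J = "edge u ` S"])
        show "determined_by {edge x u} (\<lambda>c. of_bool (D x u c))"
          by (rule determined_by_comp) (rule determined_D[OF *])
        show "determined_by (edge u ` S) ?N"
        proof (rule determined_byI)
          fix c c' :: "'e \<Rightarrow> 'b" assume c: "\<And>e. e \<in> edge u ` S \<Longrightarrow> c e = c' e"
          have "D u s c = D u s c'" if "s \<in> S" for s
            by (rule determined_byD_D[OF c]) (use that SU * in auto)
          then show "?N c = ?N c'" by (intro prod.cong) auto
        qed
        show "{edge x u} \<subseteq> U" using * edge_in by auto
        show "{edge x u} \<inter> edge u ` S = {}"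
          using edge_eq[of x u u] S SU * by (auto simp: doubleton_eq_iff)
      qed (simp add: expectation_D)
      finally have "E (\<lambda>c. of_bool (?Q u c)) = (1 - q x u) + q x u * E ?N" .
      moreover have "q x u * E ?N \<le> q x u * r"
        unfolding r_def using q_bounds * SU by (intro mult_left_mono expectation_no_out_nbr) auto
      ultimately show ?thesis by (simp add: algebra_simps)
    qed
    also have "\<dots> \<le> exp (- ((1 - r) * q x u))"
      using exp_ge_add_one_self[of "- ((1 - r) * q x u)"] by simp
    finally show "0 \<le> E (\<lambda>c. of_bool (?Q u c)) \<and>
                  E (\<lambda>c. of_bool (?Q u c)) \<le> exp (- ((1 - r) * q x u))"
      by (simp add: prob_eq_expectation[symmetric] del: of_bool_eq_iff)
  qed
  also have "\<dots> = exp (- ((1 - r) * (\<Sum>u\<in>W. q x u)))"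
    using finW by (simp add: exp_sum[symmetric] sum_negf sum_distrib_left)
  finally show ?thesis unfolding r_def .
qed

section \<open>Large out-neighbourhoods and three-step paths\<close>

text \<open>A Chernoff bound: Markov's inequality for \<open>exp (- X)\<close>, with
  \<open>X\<close> the out-degree, where each independent factor has expectation at most
  \<open>1 - q w j / 2\<close>.\<close>

lemma prob_few_out_nbrs:
  fixes a :: real
  assumes w: "w \<in> V"
  shows "measure_pmf.prob P {c. card (out_nbrs w c) \<le> a} \<le> exp (a - out_mean w / 2)"
proof -
  let ?f = "\<lambda>j c. exp (- of_bool (D w j c)) :: real"
  have finW: "finite (V - {w})" using finite_V by simp
  have half: "exp (- 1) \<le> (1 / 2 :: real)"
    using exp_ge_add_one_self[of "1::real"] by (simp add: exp_minus field_simps)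
  have card: "(\<Prod>j\<in>V - {w}. ?f j c) = exp (- card (out_nbrs w c))" for c
    using finW by (simp add: exp_sum[symmetric] sum_negf out_nbrs_def sum.If_cases of_bool_def Int_def)
  have "measure_pmf.prob P {c. card (out_nbrs w c) \<le> a} = 
      E (\<lambda>c. of_bool (card (out_nbrs w c) \<le> a))"
    by (rule prob_eq_expectation)
  also have "\<dots> \<le> E (\<lambda>c. exp a * (\<Prod>j\<in>V - {w}. ?f j c))"
    unfolding card by (intro integral_mono) (auto simp: exp_add[symmetric])
  also have "\<dots> = exp a * E (\<lambda>c. \<Prod>j\<in>V - {w}. ?f j c)"
    by simp
  finally have le: "measure_pmf.prob P {c. card (out_nbrs w c) \<le> a} \<le> \<dots>" .
  have "E (\<lambda>c. \<Prod>j\<in>V - {w}. ?f j c) = (\<Prod>j\<in>V - {w}. E (?f j))"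
  proof (rule expectation_prod[OF finW, where I = "\<lambda>j. {edge w j}"])
    fix j assume "j \<in> V - {w}"
    then have j: "w \<in> V" "j \<in> V" "w \<noteq> j" using w by auto
    show "{edge w j} \<subseteq> U" using edge_in j by simp
    show "determined_by {edge w j} (?f j)"
      by (rule determined_by_comp[where h = "\<lambda>b. exp (- of_bool b)"]) (rule determined_D[OF j])
  qed (use w in \<open>auto intro!: edge_star_disjoint\<close>)
  also have "\<dots> \<le> (\<Prod>j\<in>V - {w}. exp (- (q w j / 2)))"
  proof (rule prod_mono)
    fix j
    \<comment> \<open>\<open>exp (- b) \<le> 1 - b / 2\<close> holds at \<open>b = 0\<close> and
      \<open>b = 1\<close>, the only values of the indicator.\<close>
    have "E (?f j) \<le> E (\<lambda>c. 1 - of_bool (D w j c) / 2)"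
      using half by (intro integral_mono) (auto simp: of_bool_def)
    also have "\<dots> = 1 - q w j / 2"
      by (simp add: expectation_D)
    also have "\<dots> \<le> exp (- (q w j / 2))"
      using exp_ge_add_one_self[of "- (q w j / 2)"] by simp
    finally show "0 \<le> E (?f j) \<and> E (?f j) \<le> exp (- (q w j / 2))"
      by simp
  qed
  also have "\<dots> = exp (- (out_mean w / 2))"
    using finW by (simp add: exp_sum[symmetric] sum_negf out_mean_def sum_divide_distrib)
  finally have "exp a * E (\<lambda>c. \<Prod>j\<in>V - {w}. ?f j c) \<le> exp a * exp (- (out_mean w / 2))"
    by (intro mult_left_mono) auto
  with le show ?thesis by (simp add: mult_exp_exp)
qed

text \<open>Read backwards from \<open>y\<close>, a path through \<open>s\<close> and
  \<open>u\<close> is a two-step search for the set \<open>out_nbrs w c\<close>. Excluding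
  \<open>u = w\<close> keeps the search independent of that set.\<close>

lemma prob_no_three_step:
  fixes a :: real
  assumes w: "w \<in> V" and y: "y \<in> V" and wy: "w \<noteq> y"
  shows "measure_pmf.prob P {c. a \<le> card (out_nbrs w c) \<and> y \<notin> out_nbrs w c \<and>
            (\<forall>u\<in>V - {w, y}. D u y c \<longrightarrow> u \<notin> out_nbrs w c \<and> (\<forall>s\<in>out_nbrs w c. \<not> D s u c))}
         \<le> exp (- ((1 - exp (- (\<delta> * a))) * (\<Sum>u\<in>V - {w, y}. q u y)))"
  (is "measure_pmf.prob P {c. ?F c} \<le> ?b")
proof -
  interpret rev: random_orientation V U dflt B edge "\<lambda>i j. D j i" \<delta>
    by (rule reverse)
  have rev: "rev.q i j = q j i" for i j
    by (simp add: rev.q_def q_def)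
  \<comment> \<open>Condition on the out-neighbourhood \<open>A\<close> of \<open>w\<close>: what remains is a two-step event of the reversed
    tournament that does not read the edges at \<open>w\<close>.\<close>
  define \<A> where "\<A> = {A. A \<subseteq> V - {w} \<and> y \<notin> A \<and> a \<le> card A}"
  have fin: "finite \<A>"
    using finite_V by (auto simp: \<A>_def intro: finite_subset[of _ "Pow V"])
  let ?Q = "\<lambda>A c. \<forall>u\<in>V - {w, y}. D u y c \<longrightarrow> u \<notin> A \<and> (\<forall>s\<in>A. \<not> D s u c)"
  let ?I = "edge w ` (V - {w})" and ?J = "{edge i j | i j. i \<in> V - {w} \<and> j \<in> V - {w} \<and> i \<noteq> j}"
  have Q_le: "E (\<lambda>c. of_bool (?Q A c)) \<le> ?b" if A: "A \<in> \<A>" for A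
  proof -
    have "E (\<lambda>c. of_bool (?Q A c)) \<le>
        exp (- ((1 - exp (- (\<delta> * card A))) * (\<Sum>u\<in>V - {w, y}. q u y)))"
      \<comment> \<open>\<open>y \<notin> A\<close> makes \<open>A\<close> an admissible target set
        for a search starting at \<open>y\<close>.\<close>
      using rev.prob_no_two_step[of y A "V - {w, y}"] A y
      unfolding prob_eq_expectation rev by (auto simp: \<A>_def)
    also have "\<dots> \<le> ?b"
      using A delta_nonneg q_bounds
      by (auto simp: \<A>_def intro!: mult_right_mono sum_nonneg mult_left_mono)
    finally show ?thesis .
  qed
  have split: "E (\<lambda>c. of_bool (out_nbrs w c = A) * of_bool (?Q A c)) =
      E (\<lambda>c. of_bool (out_nbrs w c = A)) * E (\<lambda>c. of_bool (?Q A c))" if A: "A \<in> \<A>" for A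
  proof (rule expectation_mult[where I = ?I and J = ?J])
    show "?I \<subseteq> U" using w by (auto intro!: edge_in)
    show "determined_by ?I (\<lambda>c. of_bool (out_nbrs w c = A))"
    proof (rule determined_byI)
      fix c c' :: "'e \<Rightarrow> 'b" assume c: "\<And>e. e \<in> ?I \<Longrightarrow> c e = c' e"
      have "D w u c = D w u c'" if "u \<in> V - {w}" for u
        by (rule determined_byD_D[OF c]) (use w that in auto)
      then have "out_nbrs w c = out_nbrs w c'" by (auto simp: out_nbrs_def)
      then show "of_bool (out_nbrs w c = A) = of_bool (out_nbrs w c' = A)" by simp
    qed
    show "determined_by ?J (\<lambda>c. of_bool (?Q A c))"
    proof (rule determined_byI)
      fix c c' :: "'e \<Rightarrow> 'b" assume c: "\<And>e. e \<in> ?J \<Longrightarrow> c e = c' e"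
      have "D i j c = D i j c'" if "i \<in> V - {w}" "j \<in> V - {w}" "i \<noteq> j" for i j
        by (rule determined_byD_D[OF c]) (use that in blast)+
      then have "D u y c = D u y c'" "u \<notin> A \<Longrightarrow> s \<in> A \<Longrightarrow> D s u c = D s u c'"
        if "u \<in> V - {w, y}" for u s
        using that A y wy by (auto simp: \<A>_def)
      then have "?Q A c = ?Q A c'"
        by (intro ball_cong refl) blast
      then show "of_bool (?Q A c) = of_bool (?Q A c')" by simp
    qed
    show "?I \<inter> ?J = {}"
    proof -
      have "edge w u \<noteq> edge i j" if "u \<in> V - {w}" "i \<in> V - {w}" "j \<in> V - {w}" "i \<noteq> j" for u i j
        using edge_eq[of w u i j] that w by (auto simp: doubleton_eq_iff)
      then show ?thesis by blast
    qed
  qed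
  have "measure_pmf.prob P {c. ?F c} = E (\<lambda>c. of_bool (?F c))"
    by (rule prob_eq_expectation)
  also have "\<dots> \<le> E (\<lambda>c. \<Sum>A\<in>\<A>. of_bool (out_nbrs w c = A) * of_bool (?Q A c))"
  proof (intro integral_mono)
    fix c
    show "of_bool (?F c) \<le> (\<Sum>A\<in>\<A>. of_bool (out_nbrs w c = A) * of_bool (?Q A c) :: real)"
    proof (cases "?F c")
      case True
      then have "out_nbrs w c \<in> \<A>" by (auto simp: \<A>_def out_nbrs_def)
      then have "of_bool (out_nbrs w c = out_nbrs w c) * of_bool (?Q (out_nbrs w c) c) \<le>
          (\<Sum>A\<in>\<A>. of_bool (out_nbrs w c = A) * of_bool (?Q A c) :: real)"
        using fin by (intro member_le_sum) auto
      with True show ?thesis by simp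
    qed (auto intro: sum_nonneg)
  qed auto
  also have "\<dots> = (\<Sum>A\<in>\<A>. E (\<lambda>c. of_bool (out_nbrs w c = A)) * E (\<lambda>c. of_bool (?Q A c)))"
    using split by simp
  also have "\<dots> \<le> (\<Sum>A\<in>\<A>. E (\<lambda>c. of_bool (out_nbrs w c = A)) * ?b)"
    using Q_le by (intro sum_mono mult_left_mono) auto
  also have "\<dots> = E (\<lambda>c. \<Sum>A\<in>\<A>. of_bool (out_nbrs w c = A)) * ?b"
    by (simp add: sum_distrib_right)
  also have "\<dots> \<le> 1 * ?b"
  proof (intro mult_right_mono)
    \<comment> \<open>For each \<open>c\<close> at most one \<open>A\<close> equals
      \<open>out_nbrs w c\<close>, so no union bound over the sets is paid.\<close>
    have "E (\<lambda>c. \<Sum>A\<in>\<A>. of_bool (out_nbrs w c = A)) \<le> E (\<lambda>c. 1)"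
      using fin by (intro integral_mono) (auto simp: of_bool_def)
    then show "E (\<lambda>c. \<Sum>A\<in>\<A>. of_bool (out_nbrs w c = A)) \<le> 1" by simp
  qed simp
  finally show ?thesis by simp
qed

section \<open>Vertices of linear expected out-degree\<close>

definition dom_rel :: "('e \<Rightarrow> 'b) \<Rightarrow> 'a rel" where
  "dom_rel c = {(i, j). i \<in> V \<and> j \<in> V \<and> i \<noteq> j \<and> D i j c}"

text \<open>The constant \<open>10\<close> only has to leave more than half of the vertices in this set.\<close>

definition big_out :: "'a set" where
  "big_out = {x \<in> V. card V / 10 \<le> out_mean x}"

lemma big_out_subset: "big_out \<subseteq> V"
  by (auto simp: big_out_def)

text \<open>Double counting: since \<open>q x u + q u x = 1\<close>, the expected number of arcs
  inside \<open>S\<close> is exactly half of \<open>card S * (card S - 1)\<close>, yet it is at most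
  \<open>card S * d\<close>.\<close>

lemma card_small_out_mean:
  fixes d :: real
  assumes S: "S \<subseteq> V" and small: "\<And>x. x \<in> S \<Longrightarrow> out_mean x < d" and d: "0 \<le> d"
  shows "card S \<le> 2 * d + 1"
proof (cases "S = {}")
  case False
  have fin: "finite S" using S finite_V finite_subset by blast
  \<comment> \<open>The zero diagonal lets both sums range over all of \<open>S\<close>, so that
    they can be swapped.\<close>
  let ?f = "\<lambda>x u. if u = x then 0 else q x u"
  have "(\<Sum>u\<in>S. ?f x u) \<le> d" if x: "x \<in> S" for x
  proof -
    have "(\<Sum>u\<in>S. ?f x u) = (\<Sum>u\<in>S - {x}. q x u)"
      using fin by (intro sum.mono_neutral_cong_right) auto
    also have "\<dots> \<le> out_mean x"
      unfolding out_mean_def using S finite_V q_bounds by (intro sum_mono2) auto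
    finally show ?thesis using small[OF x] by simp
  qed
  then have "(\<Sum>x\<in>S. \<Sum>u\<in>S. ?f x u) \<le> card S * d"
    by (intro sum_bounded_above)
  moreover have "2 * (\<Sum>x\<in>S. \<Sum>u\<in>S. ?f x u) = card S * (real (card S) - 1)"
  proof -
    have "2 * (\<Sum>x\<in>S. \<Sum>u\<in>S. ?f x u) = (\<Sum>x\<in>S. \<Sum>u\<in>S. ?f x u) + (\<Sum>x\<in>S. \<Sum>u\<in>S. ?f u x)"
      by (subst (3) sum.swap) simp
    also have "\<dots> = (\<Sum>x\<in>S. \<Sum>u\<in>S. if u = x then 0 else 1)"
      unfolding sum.distrib[symmetric] using S q_reverse by (intro sum.cong) auto
    also have "\<dots> = (\<Sum>x\<in>S. real (card S) - 1)"
    proof (rule sum.cong[OF refl])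
      fix x assume x: "x \<in> S"
      have "(\<Sum>u\<in>S. if u = x then 0 else 1) = (\<Sum>u\<in>S - {x}. 1 :: real)"
        using fin by (intro sum.mono_neutral_cong_right) auto
      also have "\<dots> = real (card S) - 1"
        using card.remove[OF fin x] by simp
      finally show "(\<Sum>u\<in>S. if u = x then 0 else 1) = real (card S) - 1" .
    qed
    finally show ?thesis by simp
  qed
  ultimately have "card S * (real (card S) - 1) \<le> card S * (2 * d)"
    by simp
  moreover have "0 < card S" using False fin by (simp add: card_gt_0_iff)
  ultimately show ?thesis by simp
qed (use d in simp)

text \<open>With n = \<open>card V\<close>, at most n/5 + 1 vertices are not big, and removing
  \<open>x\<close> costs one more; 4n/5 - 2 >= n/2 needs n >= 20/3, hence the 7.\<close>

lemma card_big_out: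
  assumes "7 \<le> card V"
  shows "card V / 2 \<le> card (big_out - {x})"
proof -
  have fin: "finite big_out" using big_out_subset finite_V finite_subset by blast
  have "card (V - big_out) \<le> 2 * (card V / 10) + 1"
    by (rule card_small_out_mean) (auto simp: big_out_def)
  moreover have "card V = card (V - big_out) + card big_out"
    using finite_V big_out_subset by (metis card_Diff_subset card_mono fin le_add_diff_inverse2)
  moreover have "card big_out \<le> card (big_out - {x}) + 1"
    using diff_card_le_card_Diff[of "{x}" big_out] by simp
  ultimately show ?thesis using assms by linarith
qed

text \<open>\<open>half_good\<close> for a tournament and for its reversal together give paths of length at most \<open>5\<close>:
  the first two clauses lead from \<open>x\<close> to \<open>big_out\<close>, the third one from there to \<open>y\<close>. Only if
  \<open>in_mean y < d\<close> is the last arc taken from the reversed first clause, and if in addition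
  \<open>d \<le> out_mean x\<close>, then the reversed third clause alone leads from \<open>x\<close> to the start of that arc.\<close>

definition half_good :: "real \<Rightarrow> ('e \<Rightarrow> 'b) \<Rightarrow> bool" where
  "half_good d c \<longleftrightarrow>
     (\<forall>x\<in>V. out_mean x < d \<longrightarrow> (\<exists>w\<in>big_out. (x, w) \<in> dom_rel c)) \<and>
     (\<forall>x\<in>V. d \<le> out_mean x \<longrightarrow> (\<exists>w\<in>big_out. (x, w) \<in> (dom_rel c)\<^sup>= ^^ 2)) \<and>
     (\<forall>w\<in>big_out. \<forall>y\<in>V. d \<le> in_mean y \<longrightarrow> (w, y) \<in> (dom_rel c)\<^sup>= ^^ 3)"

section \<open>Failure probabilities of the partial paths\<close>

text \<open>The two-step bound with \<open>W\<close> and \<open>S\<close> both equal to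
  \<open>big_out - {x}\<close> reduces to a single step. The 4 combines a factor 1/2 for the size of
  \<open>S\<close> with one for \<open>1 - exp (- (\<delta> * card S))\<close>.\<close>

lemma prob_low_no_big_nbr:
  assumes x: "x \<in> V" and N: "7 \<le> card V" "40 \<le> \<delta> * card V"
  shows "measure_pmf.prob P {c. \<not> (\<exists>w\<in>big_out. (x, w) \<in> dom_rel c)} \<le> exp (- (\<delta> * card V / 4))"
proof -
  let ?S = "big_out - {x}"
  have S: "?S \<subseteq> V - {x}" using big_out_subset by auto
  have card: "\<delta> * card V / 2 \<le> \<delta> * card ?S"
    using mult_left_mono[OF card_big_out[OF N(1), of x] delta_nonneg] by simp
  have "card ?S * \<delta> \<le> (\<Sum>u\<in>?S. q x u)"
    using x S by (intro sum_bounded_below q_ge) auto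
  then have "1 / 2 * (\<delta> * card V / 2) \<le> (1 - exp (- (\<delta> * card ?S))) * (\<Sum>u\<in>?S. q x u)"
    using card N half_le_one_minus_exp[of "\<delta> * card ?S"]
    by (intro mult_mono) (auto simp: mult.commute)
  then have "exp (- ((1 - exp (- (\<delta> * card ?S))) * (\<Sum>u\<in>?S. q x u))) \<le> exp (- (\<delta> * card V / 4))"
    by simp
  moreover have "measure_pmf.prob P {c. \<not> (\<exists>w\<in>big_out. (x, w) \<in> dom_rel c)} \<le>
      measure_pmf.prob P {c. \<forall>u\<in>?S. D x u c \<longrightarrow> u \<notin> ?S \<and> (\<forall>s\<in>?S. \<not> D u s c)}"
    by (rule prob_mono) (use x big_out_subset in \<open>auto simp: dom_rel_def\<close>)
  ultimately show ?thesis
    using prob_no_two_step[OF x S S] by linarith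
qed

text \<open>With every vertex other than \<open>x\<close> as a possible midpoint, the sum in the
  two-step bound is the full \<open>out_mean x\<close>.\<close>

lemma prob_high_no_two_step:
  assumes x: "x \<in> V" and d: "d \<le> out_mean x" "0 \<le> d" and N: "7 \<le> card V" "40 \<le> \<delta> * card V"
  shows "measure_pmf.prob P {c. \<not> (\<exists>w\<in>big_out. (x, w) \<in> (dom_rel c)\<^sup>= ^^ 2)} \<le> exp (- (d / 2))"
proof -
  let ?S = "big_out - {x}"
  have S: "?S \<subseteq> V - {x}" using big_out_subset by auto
  have card: "\<delta> * card V / 2 \<le> \<delta> * card ?S"
    using mult_left_mono[OF card_big_out[OF N(1), of x] delta_nonneg] by simp
  have "1 / 2 * d \<le> (1 - exp (- (\<delta> * card ?S))) * out_mean x"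
    using card N d half_le_one_minus_exp[of "\<delta> * card ?S"] by (intro mult_mono) auto
  then have "exp (- ((1 - exp (- (\<delta> * card ?S))) * (\<Sum>u\<in>V - {x}. q x u))) \<le> exp (- (d / 2))"
    by (simp add: out_mean_def)
  moreover have "measure_pmf.prob P {c. \<not> (\<exists>w\<in>big_out. (x, w) \<in> (dom_rel c)\<^sup>= ^^ 2)} \<le>
      measure_pmf.prob P {c. \<forall>u\<in>V - {x}. D x u c \<longrightarrow> u \<notin> ?S \<and> (\<forall>s\<in>?S. \<not> D u s c)}"
  proof (rule prob_mono, intro ballI impI)
    fix c u assume *: "\<not> (\<exists>w\<in>big_out. (x, w) \<in> (dom_rel c)\<^sup>= ^^ 2)" and u: "u \<in> V - {x}" "D x u c"
    have xu: "(x, u) \<in> (dom_rel c)\<^sup>=" using u x by (auto simp: dom_rel_def)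
    have step: "(x, s) \<in> (dom_rel c)\<^sup>= ^^ 2" if "(u, s) \<in> (dom_rel c)\<^sup>=" for s
      using xu that by (auto simp: numeral_2_eq_2 simp del: Un_iff)
    have "u \<notin> ?S" using step[of u] * by auto
    moreover have "\<not> D u s c" if "s \<in> ?S" for s
    proof
      assume "D u s c"
      then have "(u, s) \<in> (dom_rel c)\<^sup>=" using u that S by (auto simp: dom_rel_def)
      then show False using step[of s] * that by auto
    qed
    ultimately show "u \<notin> ?S \<and> (\<forall>s\<in>?S. \<not> D u s c)" by blast
  qed
  ultimately show ?thesis
    using prob_no_two_step[OF x S subset_refl] by linarith
qed

text \<open>The threshold \<open>card V / 40\<close> matches
  \<open>40 \<le> \<delta> * card V\<close>: their combination is
  \<open>1 \<le> \<delta> * (card V / 40)\<close>. Excluding \<open>w\<close> from the predecessors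
  of \<open>y\<close> costs \<open>q w y \<le> 1\<close>, hence \<open>d - 1\<close>.\<close>

lemma prob_big_no_three_step:
  assumes w: "w \<in> big_out" and y: "y \<in> V" and d: "d \<le> in_mean y" "1 \<le> d" 
    and N: "7 \<le> card V" "40 \<le> \<delta> * card V"
  shows "measure_pmf.prob P {c. card V / 40 < card (out_nbrs w c) \<and> (w, y) \<notin> (dom_rel c)\<^sup>= ^^ 3}
          \<le> exp (- ((d - 1) / 2))"
proof (cases "w = y")
  case True
  have "(y, y) \<in> (dom_rel c)\<^sup>= ^^ 3" for c
    by (rule relpow_reflcl_mono[where j = 0]) auto
  with True show ?thesis by simp
next
  case False
  have wV: "w \<in> V" using w big_out_subset by auto
  let ?a = "card V / 40"
  have "in_mean y = q w y + (\<Sum>u\<in>V - {w, y}. q u y)"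
    unfolding in_mean_def using finite_V wV False
    by (subst sum.remove[of _ w]) (auto intro!: sum.cong)
  then have "d - 1 \<le> (\<Sum>u\<in>V - {w, y}. q u y)"
    using d q_bounds[of w y] by linarith
  then have "1 / 2 * (d - 1) \<le> (1 - exp (- (\<delta> * ?a))) * (\<Sum>u\<in>V - {w, y}. q u y)"
    using N d half_le_one_minus_exp[of "\<delta> * ?a"] by (intro mult_mono) auto
  then have "exp (- ((1 - exp (- (\<delta> * ?a))) * (\<Sum>u\<in>V - {w, y}. q u y))) \<le> exp (- ((d - 1) / 2))"
    by simp
  moreover have "measure_pmf.prob P {c. card V / 40 < card (out_nbrs w c) \<and> (w, y) \<notin> (dom_rel c)\<^sup>= ^^ 3} \<le>
     measure_pmf.prob P {c. ?a \<le> card (out_nbrs w c) \<and> y \<notin> out_nbrs w c \<and>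
            (\<forall>u\<in>V - {w, y}. D u y c \<longrightarrow> u \<notin> out_nbrs w c \<and> (\<forall>s\<in>out_nbrs w c. \<not> D s u c))}"
  proof (rule prob_mono, elim conjE, intro conjI ballI impI notI)
    fix c assume *: "(w, y) \<notin> (dom_rel c)\<^sup>= ^^ 3"
    have out: "(w, u) \<in> (dom_rel c)\<^sup>= ^^ 1" if "u \<in> out_nbrs w c" for u
      using that wV by (auto simp: out_nbrs_def dom_rel_def)
    have dom: "(u, v) \<in> (dom_rel c)\<^sup>= ^^ 1" if "u \<in> V" "v \<in> V" "u \<noteq> v" "D u v c" for u v
      using that by (auto simp: dom_rel_def)
    show False if "y \<in> out_nbrs w c"
      using relpow_reflcl_mono[OF out[OF that], of 3] * by simp
    fix u assume u: "u \<in> V - {w, y}" "D u y c"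
    then have uy: "(u, y) \<in> (dom_rel c)\<^sup>= ^^ 1" using dom y by auto
    show nu: False if "u \<in> out_nbrs w c"
      using relpow_reflcl_add[OF out[OF that] uy, of 3] * by simp
    fix s assume s: "s \<in> out_nbrs w c" "D s u c"
    then have "s \<noteq> u" "s \<in> V" using nu by (auto simp: out_nbrs_def)
    then have "(s, u) \<in> (dom_rel c)\<^sup>= ^^ 1" using dom s u by auto
    then have "(s, y) \<in> (dom_rel c)\<^sup>= ^^ 2" using uy by (rule relpow_reflcl_add) simp
    then show False
      using relpow_reflcl_add[OF out[OF s(1)], of y 2 3] * by simp
  qed auto
  ultimately show ?thesis
    using prob_no_three_step[OF wV y False, of ?a] by linarith
qed

text \<open>A union bound over four kinds of failure. The bound
  \<open>exp (- (\<delta> * card V / 4))\<close> for low vertices is paid only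
  \<open>2 * d + 1\<close> times rather than \<open>card V\<close> times.\<close>

lemma prob_not_half_good:
  assumes d: "1 \<le> d" and N: "7 \<le> card V" "40 \<le> \<delta> * card V"
  shows "measure_pmf.prob P {c. \<not> half_good d c} \<le>
     (2 * d + 1) * exp (- (\<delta> * card V / 4)) + card V * exp (- (d / 2)) +
     card V * exp (- (card V / 40)) + (real (card V))\<^sup>2 * exp (- ((d - 1) / 2))"
proof -
  define L where "L = {x \<in> V. out_mean x < d}"
  define H where "H = {x \<in> V. d \<le> out_mean x}"
  define Y where "Y = {y \<in> V. d \<le> in_mean y}"
  have fin: "finite L" "finite H" "finite Y" "finite big_out"
    using finite_V by (auto simp: L_def H_def Y_def big_out_def)
  have cards: "card H \<le> card V" "card Y \<le> card V" "card big_out \<le> card V"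
    using finite_V by (auto simp: H_def Y_def big_out_def intro!: card_mono)
  let ?Q1 = "\<lambda>c. \<exists>x\<in>L. \<not> (\<exists>w\<in>big_out. (x, w) \<in> dom_rel c)"
  let ?Q2 = "\<lambda>c. \<exists>x\<in>H. \<not> (\<exists>w\<in>big_out. (x, w) \<in> (dom_rel c)\<^sup>= ^^ 2)"
  let ?Q3 = "\<lambda>c. \<exists>w\<in>big_out. card (out_nbrs w c) \<le> card V / 40"
  let ?Q4 = "\<lambda>c. \<exists>p\<in>big_out \<times> Y. card V / 40 < card (out_nbrs (fst p) c) \<and>
      (fst p, snd p) \<notin> (dom_rel c)\<^sup>= ^^ 3"
  have "measure_pmf.prob P {c. \<not> half_good d c} \<le>
      measure_pmf.prob P {c. ((?Q1 c \<or> ?Q2 c) \<or> ?Q3 c) \<or> ?Q4 c}"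
  proof (rule prob_mono, rule ccontr)
    fix c assume "\<not> half_good d c" and n: "\<not> (((?Q1 c \<or> ?Q2 c) \<or> ?Q3 c) \<or> ?Q4 c)"
    moreover have "(w, y) \<in> (dom_rel c)\<^sup>= ^^ 3" if "w \<in> big_out" "y \<in> Y" for w y
      using n that by fastforce
    ultimately show False
      unfolding half_good_def L_def H_def Y_def by blast
  qed
  also have "\<dots> \<le> measure_pmf.prob P {c. ?Q1 c} + measure_pmf.prob P {c. ?Q2 c} +
      measure_pmf.prob P {c. ?Q3 c} + measure_pmf.prob P {c. ?Q4 c}"
    by (intro order_trans[OF prob_disj_le] add_mono prob_disj_le order_refl)
  also have "measure_pmf.prob P {c. ?Q1 c} \<le> (2 * d + 1) * exp (- (\<delta> * card V / 4))"
  proof -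
    have "measure_pmf.prob P {c. ?Q1 c} \<le> card L * exp (- (\<delta> * card V / 4))"
      using fin N by (intro prob_Ex_le prob_low_no_big_nbr) (auto simp: L_def)
    also have "\<dots> \<le> (2 * d + 1) * exp (- (\<delta> * card V / 4))"
      using d by (intro mult_right_mono card_small_out_mean) (auto simp: L_def)
    finally show ?thesis .
  qed
  also have "measure_pmf.prob P {c. ?Q2 c} \<le> card V * exp (- (d / 2))"
  proof -
    have "measure_pmf.prob P {c. ?Q2 c} \<le> card H * exp (- (d / 2))"
      using fin N d by (intro prob_Ex_le prob_high_no_two_step) (auto simp: H_def)
    also have "\<dots> \<le> card V * exp (- (d / 2))"
      using cards by (intro mult_right_mono) auto
    finally show ?thesis .
  qed
  also have "measure_pmf.prob P {c. ?Q3 c} \<le> card V * exp (- (card V / 40))"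
  proof -
    have "measure_pmf.prob P {c. ?Q3 c} \<le> card big_out * exp (- (card V / 40))"
    proof (rule prob_Ex_le)
      fix w assume w: "w \<in> big_out"
      then have "measure_pmf.prob P {c. card (out_nbrs w c) \<le> card V / 40} \<le>
          exp (card V / 40 - out_mean w / 2)"
        using big_out_subset by (intro prob_few_out_nbrs) auto
      \<comment> \<open>A big vertex has \<open>card V / 20 \<le> out_mean w / 2\<close>, twice the
        threshold.\<close>
      also have "\<dots> \<le> exp (- (card V / 40))"
        using w by (simp add: big_out_def)
      finally show "measure_pmf.prob P {c. card (out_nbrs w c) \<le> card V / 40} \<le> \<dots>" .
    qed (use fin in auto)
    also have "\<dots> \<le> card V * exp (- (card V / 40))"
      using cards by (intro mult_right_mono) auto
    finally show ?thesis .
  qed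
  also have "measure_pmf.prob P {c. ?Q4 c} \<le> (real (card V))\<^sup>2 * exp (- ((d - 1) / 2))"
  proof -
    have "measure_pmf.prob P {c. ?Q4 c} \<le> card (big_out \<times> Y) * exp (- ((d - 1) / 2))"
      using fin N d by (intro prob_Ex_le prob_big_no_three_step) (auto simp: Y_def)
    also have "real (card (big_out \<times> Y)) \<le> (real (card V))\<^sup>2"
      using cards by (simp add: card_cartesian_product power2_eq_square mult_mono)
    finally show ?thesis by (simp add: mult_right_mono)
  qed
  finally show ?thesis by simp
qed

section \<open>Paths of length at most five\<close>

lemma prob_not_all_within_5:
  assumes d: "1 \<le> d" "d \<le> card V / 10" and N: "7 \<le> card V" "40 \<le> \<delta> * card V"
  shows "measure_pmf.prob P {c. \<not> (\<forall>x\<in>V. \<forall>y\<in>V. (x, y) \<in> (dom_rel c)\<^sup>= ^^ 5)} \<le>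
     2 * ((2 * d + 1) * exp (- (\<delta> * card V / 4)) + card V * exp (- (d / 2)) +
     card V * exp (- (card V / 40)) + (real (card V))\<^sup>2 * exp (- ((d - 1) / 2)))"
    (is "_ \<le> 2 * ?b")
proof -
  interpret rev: random_orientation V U dflt B edge "\<lambda>i j. D j i" \<delta>
    by (rule reverse)
  have rev_q: "rev.q i j = q j i" for i j
    by (simp add: rev.q_def q_def)
  have rev_mean: "rev.out_mean x = in_mean x" "rev.in_mean x = out_mean x" for x
    by (simp_all add: rev.out_mean_def rev.in_mean_def out_mean_def in_mean_def rev_q)
  have "rev.dom_rel c = (dom_rel c)\<inverse>" for c
    by (auto simp: rev.dom_rel_def dom_rel_def)
  then have rev_pow: "(x, y) \<in> (rev.dom_rel c)\<^sup>= ^^ k \<longleftrightarrow> (y, x) \<in> (dom_rel c)\<^sup>= ^^ k" for x y c k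
    using relpow_converse[where R = "(dom_rel c)\<^sup>=" and k = k] by (simp add: converse_Un)
  have "measure_pmf.prob P {c. \<not> (\<forall>x\<in>V. \<forall>y\<in>V. (x, y) \<in> (dom_rel c)\<^sup>= ^^ 5)} \<le>
      measure_pmf.prob P {c. \<not> half_good d c \<or> \<not> rev.half_good d c}"
  proof (rule prob_mono, rule ccontr)
    fix c assume "\<not> (\<forall>x\<in>V. \<forall>y\<in>V. (x, y) \<in> (dom_rel c)\<^sup>= ^^ 5)"
      and good: "\<not> (\<not> half_good d c \<or> \<not> rev.half_good d c)"
    then obtain x y where xy: "x \<in> V" "y \<in> V" and not: "(x, y) \<notin> (dom_rel c)\<^sup>= ^^ 5"
      by blast
    \<comment> \<open>The exponent stays 1 for a low \<open>x\<close>: if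
      \<open>in_mean y < d\<close> as well, the route is 1 + 3 + 1 and has no step to spare.\<close>
    have A: "\<exists>w\<in>big_out. (x, w) \<in> (dom_rel c)\<^sup>= ^^ (if out_mean x < d then 1 else 2)"
    proof (cases "out_mean x < d")
      case True
      then obtain w where "w \<in> big_out" "(x, w) \<in> dom_rel c"
        using good xy unfolding half_good_def by blast
      then show ?thesis using True by auto
    next
      case False
      then show ?thesis using good xy unfolding half_good_def by auto
    qed
    have B: "(w, y) \<in> (dom_rel c)\<^sup>= ^^ 3" if "w \<in> big_out" "y \<in> V" "d \<le> in_mean y" for w y
      using good that unfolding half_good_def by blast
    show False
    proof (cases "in_mean y < d")
      case False
      from A obtain w where w: "w \<in> big_out"
          "(x, w) \<in> (dom_rel c)\<^sup>= ^^ (if out_mean x < d then 1 else 2)"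
        by blast
      have "(w, y) \<in> (dom_rel c)\<^sup>= ^^ 3" using B w False xy by simp
      moreover have "(if out_mean x < d then 1 else 2) + 3 \<le> (5::nat)" by simp
      ultimately have "(x, y) \<in> (dom_rel c)\<^sup>= ^^ 5" by (rule relpow_reflcl_add[OF w(2)])
      with not show False ..
    next
      case True
      then obtain z where z: "z \<in> rev.big_out" "(y, z) \<in> rev.dom_rel c"
        using good xy unfolding rev.half_good_def rev_mean by blast
      then have zy: "(z, y) \<in> (dom_rel c)\<^sup>= ^^ 1"
        using rev_pow[of y z 1 c] by auto
      \<comment> \<open>Bigness in the reversal means expected in-degree at least
        \<open>card V / 10\<close>, and \<open>d\<close> was assumed not to exceed this.\<close>
      have z_in: "z \<in> V" "d \<le> in_mean z"
        using z d by (auto simp: rev.big_out_def rev_mean)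
      have "(x, z) \<in> (dom_rel c)\<^sup>= ^^ 4"
      proof (cases "out_mean x < d")
        case True
        with A obtain w where w: "w \<in> big_out" "(x, w) \<in> (dom_rel c)\<^sup>= ^^ 1"
          by auto
        show ?thesis
          by (rule relpow_reflcl_add[OF w(2) B]) (use w z_in in auto)
      next
        case False
        then have "(z, x) \<in> (rev.dom_rel c)\<^sup>= ^^ 3"
          using good z xy unfolding rev.half_good_def rev_mean by auto
        then show ?thesis
          unfolding rev_pow by (rule relpow_reflcl_mono) simp
      qed
      from relpow_reflcl_add[OF this zy, of 5] not show False by simp
    qed
  qed
  also have "\<dots> \<le> measure_pmf.prob P {c. \<not> half_good d c} + measure_pmf.prob P {c. \<not> rev.half_good d c}"
    by (rule prob_disj_le)
  also have "\<dots> \<le> ?b + ?b"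
    using d N by (intro add_mono prob_not_half_good rev.prob_not_half_good)
  finally show ?thesis by simp
qed

end

section \<open>The random tournament\<close>

text \<open>\<open>king\<close> demands paths without repeated vertices; cutting cycles out of a
  walk only deletes arcs.\<close>

lemma (in wf_digraph) length_awalk_to_apath_le:
  assumes "awalk u p v"
  shows "length (awalk_to_apath p) \<le> length p"
  using assms
proof (induct rule: awalk_to_apath_induct)
  case (path p)
  then have "awalk_to_apath p = p"
    by (auto simp: awalk_to_apath.simps)
  then show ?case by simp
next
  case (decomp p q r s)
  then have "awalk_to_apath p = awalk_to_apath (q @ s)"
    by (intro step_awalk_to_apath)
  moreover have "p = q @ r @ s"
    using awalk_cyc_decomp_has_prop[OF decomp(1,3)] decomp(2) by auto
  ultimately show ?case using decomp(4) by simp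
qed

text \<open>Pauses contribute no arc to the walk, and its cycles are then cut out.\<close>

lemma (in pair_wf_digraph) apath_of_relpow:
  assumes "x \<in> pverts G" "(x, y) \<in> (parcs G)\<^sup>= ^^ k"
  shows "\<exists>es. apath x es y \<and> length es \<le> k"
proof -
  have "\<exists>es. awalk x es y \<and> length es \<le> k"
    using assms
  proof (induction k arbitrary: x)
    case 0
    then have "awalk x [] y" by (simp add: awalk_Nil_iff)
    then show ?case by auto
  next
    case (Suc k)
    then obtain z where z: "x = z \<or> (x, z) \<in> parcs G" "(z, y) \<in> (parcs G)\<^sup>= ^^ k"
      using relpow_Suc_D2[OF Suc.prems(2)] by auto
    then have "z \<in> pverts G" using Suc.prems(1) arc_snd_in_verts[of "(x, z)"] by auto
    then obtain es where es: "awalk z es y" "length es \<le> k" using Suc.IH z(2) by blast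
    show ?case
    proof (cases "x = z")
      case True
      then show ?thesis using es by (auto intro: le_SucI)
    next
      case False
      then have "awalk x ((x, z) # es) y" using z(1) es(1) by (simp add: awalk_Cons_iff)
      then show ?thesis using es(2) by (intro exI[of _ "(x, z) # es"]) simp
    qed
  qed
  then obtain es where "awalk x es y" "length es \<le> k" by blast
  then show ?thesis
    using apath_awalk_to_apath length_awalk_to_apath_le le_trans by blast
qed

section \<open>The bound for fixed \<open>n\<close> and its limit\<close>

lemma prob_all_5_kings_ge:
  fixes p :: "nat \<Rightarrow> nat \<Rightarrow> real"
  assumes valid: "valid_probs n p"
    and ge: "\<And>i j. \<lbrakk>i \<in> {1..n}; j \<in> {1..n}; i \<noteq> j\<rbrakk> \<Longrightarrow> \<delta> \<le> p i j"
    and d: "1 \<le> d" "d \<le> n / 10" and n: "7 \<le> n" "40 \<le> \<delta> * n"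
  shows "1 - 2 * ((2 * d + 1) * exp (- (\<delta> * n / 4)) + n * exp (- (d / 2)) +
           n * exp (- (n / 40)) + (real n)\<^sup>2 * exp (- ((d - 1) / 2)))
         \<le> measure_pmf.prob (random_tournament n p) {T. \<forall>x\<in>pverts T. king 5 T x}"
proof -
  let ?B = "\<lambda>(i, j). bernoulli_pmf (p i j)"
  let ?P = "Pi_pmf (unordered_pairs n) False ?B"
  have prob: "measure_pmf.prob (random_tournament n p) {T. K T} =
      measure_pmf.prob ?P {c. K (tournament_of n c)}" for K
    by (simp add: random_tournament_def measure_map_pmf vimage_def)
  \<comment> \<open>The coin of a pair is indexed with the smaller number first, as in
    \<open>unordered_pairs\<close>.\<close>
  interpret random_orientation "{1..n}" "unordered_pairs n" False ?B
    "\<lambda>i j. (min i j, max i j)" "\<lambda>i j c. (i, j) \<in> parcs (tournament_of n c)" \<delta>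
  proof (unfold_locales, goal_cases)
    case 2 
    show ?case by (rule finite_unordered_pairs)
  next
    case (3 i j)
    then show ?case by (auto simp: unordered_pairs_def min_def max_def)
  next
    case (5 i j k l)
    then show ?case by (auto simp: min_def max_def split: if_splits)
  next
    case (6 i j)
    then show ?case
      by (intro determined_byI) (auto simp: tournament_of_def unordered_pairs_def min_def max_def split: if_splits)
  next
    case (7 i j c)
    then show ?case
      using tournament_tournament_of[of n c] by (auto simp: tournament_def tournament_of_def unordered_pairs_def)
  next
    case 8
    \<comment> \<open>A negative \<open>\<delta>\<close> would contradict
      \<open>40 \<le> \<delta> * n\<close>.\<close>
    show ?case
      by (rule ccontr) (use n mult_nonpos_nonneg[of \<delta> "real n"] in auto)
  next
    case (9 i j)
    then have "measure_pmf.prob ?P {c. (i, j) \<in> parcs (tournament_of n c)} = p i j"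
      using prob_dominates[OF valid, of i j] prob[of "\<lambda>T. (i, j) \<in> parcs T"] by simp
    then show ?case using ge[of i j] 9 by simp
  qed (auto simp: min.commute max.commute)
  have king: "\<forall>x\<in>pverts (tournament_of n c). king 5 (tournament_of n c) x"
    if c: "\<forall>x\<in>{1..n}. \<forall>y\<in>{1..n}. (x, y) \<in> (dom_rel c)\<^sup>= ^^ 5" for c
  proof
    fix x assume x: "x \<in> pverts (tournament_of n c)"
    interpret pair_digraph "tournament_of n c"
      using tournament_tournament_of[of n c] by (simp add: tournament_def)
    have sub: "(dom_rel c)\<^sup>= ^^ 5 \<subseteq> (parcs (tournament_of n c))\<^sup>= ^^ 5"
      by (intro relpow_mono Un_mono order_refl) (unfold dom_rel_def, auto)
    show "king 5 (tournament_of n c) x"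
      unfolding king_def
    proof (intro conjI ballI impI x)
      fix y assume "y \<in> pverts (tournament_of n c)"
      then have "(x, y) \<in> (parcs (tournament_of n c))\<^sup>= ^^ 5"
        using c x sub by (auto simp: tournament_of_def)
      then show "\<exists>es. apath x es y \<and> length es \<le> 5"
        by (rule apath_of_relpow[OF x])
    qed
  qed
  have "1 - measure_pmf.prob P {c. \<not> (\<forall>x\<in>{1..n}. \<forall>y\<in>{1..n}. (x, y) \<in> (dom_rel c)\<^sup>= ^^ 5)} =
      measure_pmf.prob P {c. \<forall>x\<in>{1..n}. \<forall>y\<in>{1..n}. (x, y) \<in> (dom_rel c)\<^sup>= ^^ 5}"
    unfolding prob_not by simp
  also have "\<dots> \<le> measure_pmf.prob P {c. \<forall>x\<in>pverts (tournament_of n c). king 5 (tournament_of n c) x}"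
    by (rule prob_mono) (rule king)
  finally show ?thesis
    using prob_not_all_within_5[of d] d n
    unfolding prob[of "\<lambda>T. \<forall>x\<in>pverts T. king 5 T x"] P_def by simp
qed

theorem theorem5:
  fixes p :: "nat \<Rightarrow> nat \<Rightarrow> nat \<Rightarrow> real"
  assumes "\<And>n. valid_probs n (p n)"
    and "\<forall>\<^sub>F n in sequentially. \<forall>i\<in>{1..n}. \<forall>j\<in>{1..n}. i \<noteq> j \<longrightarrow>
           p n i j \<in> {50 * ln (ln (real n)) / real n .. 1 - 50 * ln (ln (real n)) / real n}"
  shows "(\<lambda>n. measure_pmf.prob (random_tournament n (p n)) {T. \<forall>x\<in>pverts T. king 5 T x})
           \<longlonglongrightarrow> 1"
proof (rule tendsto_sandwich)
  \<comment> \<open>The factor 8 makes \<open>exp (- ((d n - 1) / 2))\<close> of order n^(-4), which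
    beats the n^2 pairs in the last union bound.\<close>
  define d where "d n = 8 * ln (real n)" for n
  \<comment> \<open>The constant 50 makes the first term, for the low vertices, of order (log n)^(1
    - 50/4).\<close>
  define \<epsilon> where "\<epsilon> n = 2 * ((2 * d n + 1) * exp (- (50 * ln (ln (real n)) / 4)) +
     n * exp (- (d n / 2)) + n * exp (- (n / 40)) + (real n)\<^sup>2 * exp (- ((d n - 1) / 2)))" for n
  show "(\<lambda>n. 1 - \<epsilon> n) \<longlonglongrightarrow> 1"
    unfolding \<epsilon>_def d_def by real_asymp
  have "\<forall>\<^sub>F n in sequentially. 1 \<le> d n" "\<forall>\<^sub>F n in sequentially. d n \<le> n / 10"
       "\<forall>\<^sub>F n in sequentially. 40 \<le> 50 * ln (ln (real n))"
    unfolding d_def by real_asymp+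
  with assms(2) eventually_ge_at_top[of 7]
  show "\<forall>\<^sub>F n in sequentially. 1 - \<epsilon> n \<le>
      measure_pmf.prob (random_tournament n (p n)) {T. \<forall>x\<in>pverts T. king 5 T x}"
  proof eventually_elim
    case (elim n)
    then have "50 * ln (ln (real n)) / real n * n = 50 * ln (ln (real n))" by simp
    with elim show ?case
      using prob_all_5_kings_ge[OF assms(1), of n "50 * ln (ln (real n)) / real n" "d n"]
      unfolding \<epsilon>_def by auto
  qed
qed auto

end
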